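(* Let $n\ge2$ and $\epsilon_i\in\{-1,1\}$ for $2\le i\le n$, and define $$\alpha(\epsilon_2,\ldots,\epsilon_n):=\frac12+\frac14+\sum_{2\le i\le n}\epsilon_i\,2^{-2^i}.$$ Then the continued fraction expansion of $\alpha(\epsilon_2,\ldots,\epsilon_n)$ is $[0,1,(2R_{1,\epsilon_2,\ldots,\epsilon_n})']$, where $2R$ denotes the sequence $R$ with every term doubled and the prime indicates that the last term is increased by $1$. Consequently, for every infinite sequence $(\epsilon_i)_{i\ge2}$ over $\{-1,1\}$, the number $\alpha(\epsilon_2,\epsilon_3,\ldots):=\frac12+\frac14+\sum_{i\ge2}\epsilon_i2^{-2^i}$ has the infinite continued fraction expansion $[0,1,2R_{1,\epsilon_2,\epsilon_3,\ldots}]$.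
   Context: For a finite sequence $\mathbf f$ over $\{-1,1\}$ define $P_\epsilon=\epsilon$ (empty) and $P_{\mathbf f a}=P_{\mathbf f}\ a\ (-P_{\mathbf f}^R)$ for $a\in\{-1,1\}$, where $-x$ negates every entry and $x^R$ is reversal. For an infinite $\mathbf f=f_0f_1\cdots$, $P_{\mathbf f}$ is the unique infinite sequence having every $P_{f_0\cdots f_n}$ as a prefix. A run is a maximal block of consecutive identical entries; $R_{\mathbf f}$ is the sequence of lengths of the runs of $P_{\mathbf f}$ from left to right. Here $R_{1,\epsilon_2,\ldots,\epsilon_n}$ is $R_{\mathbf f}$ for the unfolding instructions $\mathbf f=(1,\epsilon_2,\ldots,\epsilon_n)$. $[a_0,a_1,a_2,\ldots]$ denotes the (simple) continued fraction $a_0+1/(a_1+1/(a_2+\cdots))$. *)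

theory Defs
  imports Complex_Main
begin

section \<open>Paperfolding sequences\<close>

definition paperfold :: "int list \<Rightarrow> int list" where
  "paperfold f = foldl (\<lambda>P a. P @ [a] @ map uminus (rev P)) [] f"

lemma paperfold_Nil [simp]: "paperfold [] = []"
  by (simp add: paperfold_def)

lemma paperfold_snoc [simp]:
  "paperfold (f @ [a]) = paperfold f @ [a] @ map uminus (rev (paperfold f))"
  by (simp add: paperfold_def)

lemma length_paperfold: "length (paperfold f) = 2 ^ length f - 1"
proof (induction f rule: rev_induct)
  case (snoc a f)
  have "(1::nat) \<le> 2 ^ length f" by simp
  then show ?case using snoc by simp
qed simp

definition has_prefix :: "(nat \<Rightarrow> int) \<Rightarrow> int list \<Rightarrow> bool" where
  "has_prefix p w \<longleftrightarrow> map p [0..<length w] = w"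

definition paperfold_inf :: "(nat \<Rightarrow> int) \<Rightarrow> nat \<Rightarrow> int" where
  "paperfold_inf f = (THE p. \<forall>n. has_prefix p (paperfold (map f [0..<Suc n])))"

lemma has_prefix_iff: "has_prefix p w \<longleftrightarrow> (\<forall>k<length w. p k = w ! k)"
  unfolding has_prefix_def by (subst list_eq_iff_nth_eq) simp

lemma paperfold_map_Suc:
  "paperfold (map f [0..<Suc n]) =
     paperfold (map f [0..<n]) @ [f n] @ map uminus (rev (paperfold (map f [0..<n])))"
  by simp

lemma less_length_paperfold: "k < length (paperfold (map f [0..<Suc k]))"
proof -
  have "Suc k < 2 ^ Suc k" by (rule less_exp)
  then show ?thesis by (simp only: length_paperfold) simp
qed

lemma paperfold_map_nth_mono:
  assumes "m \<le> n" "k < length (paperfold (map f [0..<m]))"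
  shows "k < length (paperfold (map f [0..<n])) \<and>
         paperfold (map f [0..<n]) ! k = paperfold (map f [0..<m]) ! k"
  using assms
proof (induction n rule: dec_induct)
  case (step n)
  then show ?case
    by (subst (1 2) paperfold_map_Suc) (auto simp: nth_append simp del: upt_Suc)
qed simp

lemma ex1_paperfold_inf: "\<exists>!p. \<forall>n. has_prefix p (paperfold (map f [0..<Suc n]))"
proof (rule ex1I)
  define q where "q = (\<lambda>k. paperfold (map f [0..<Suc k]) ! k)"
  have "q k = paperfold (map f [0..<Suc n]) ! k"
    if "k < length (paperfold (map f [0..<Suc n]))" for k n
    using that less_length_paperfold[of k f]
      paperfold_map_nth_mono[of "Suc k" "Suc n" k f]
      paperfold_map_nth_mono[of "Suc n" "Suc k" k f]
    unfolding q_def by (cases "k \<le> n") auto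
  then show "\<forall>n. has_prefix q (paperfold (map f [0..<Suc n]))"
    unfolding has_prefix_iff by blast
  fix p assume p: "\<forall>n. has_prefix p (paperfold (map f [0..<Suc n]))"
  show "p = q"
  proof
    fix k
    show "p k = q k"
      using p less_length_paperfold[of k f] unfolding has_prefix_iff q_def by blast
  qed
qed

lemma paperfold_inf_prefix: "has_prefix (paperfold_inf f) (paperfold (map f [0..<Suc n]))"
  using theI'[OF ex1_paperfold_inf[of f]] unfolding paperfold_inf_def by blast


section \<open>Run lengths\<close>

function run_lengths :: "int list \<Rightarrow> nat list" where
  "run_lengths [] = []"
| "run_lengths (x # xs) =
     Suc (length (takeWhile (\<lambda>y. y = x) xs)) # run_lengths (dropWhile (\<lambda>y. y = x) xs)"
  by pat_completeness auto
termination
  by (relation "measure length") (auto simp: le_imp_less_Suc length_dropWhile_le)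

definition run_lengths_of :: "int list \<Rightarrow> nat list" where
  "run_lengths_of f = run_lengths (paperfold f)"

text \<open>
  In an infinite sequence, the \<open>LEAST\<close> below is meaningful only if the sequence has no infinite
  run; \<open>paperfold_inf_runs_finite\<close> shows that this holds for paperfolding sequences.
\<close>

primrec run_start :: "(nat \<Rightarrow> int) \<Rightarrow> nat \<Rightarrow> nat" where
  "run_start p 0 = 0"
| "run_start p (Suc i) = (LEAST k. run_start p i < k \<and> p k \<noteq> p (run_start p i))"

definition run_lengths_inf_of :: "(nat \<Rightarrow> int) \<Rightarrow> nat \<Rightarrow> nat" where
  "run_lengths_inf_of f i =
     run_start (paperfold_inf f) (Suc i) - run_start (paperfold_inf f) i"

lemma paperfold_inf_runs_finite:
  assumes "\<forall>i. f i \<in> {-1, 1}"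
  shows "\<exists>k>m. paperfold_inf f k \<noteq> paperfold_inf f m"
proof -
  define P where "P = paperfold (map f [0..<Suc (Suc m)])"
  have entries: "x \<noteq> 0" if "x \<in> set (paperfold (map f [0..<n]))" for n x
    using that
  proof (induction n arbitrary: x)
    case (Suc n)
    have "f n \<noteq> 0" using assms[rule_format, of n] by auto
    with Suc show ?case by auto
  qed simp
  have len: "Suc m < length P"
    unfolding P_def by (rule less_length_paperfold)
  define L where "L = length P"
  have S: "paperfold (map f [0..<Suc (Suc (Suc m))]) =
           P @ [f (Suc (Suc m))] @ map uminus (rev P)"
    unfolding P_def by (rule paperfold_map_Suc)
  have nth: "paperfold_inf f k = (P @ [f (Suc (Suc m))] @ map uminus (rev P)) ! k"
    if "k < 2 * L + 1" for k
    using paperfold_inf_prefix[of f "Suc (Suc m)"] that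
    unfolding S has_prefix_iff L_def by simp
  have a: "paperfold_inf f (L - 1) = P ! (L - 1)"
    using len by (subst nth) (auto simp: nth_append L_def)
  have b: "paperfold_inf f (L + 1) = - (P ! (L - 1))"
  proof -
    have "P \<noteq> []" using len by auto
    then have "map uminus (rev P) ! 0 = - (P ! (L - 1))"
      unfolding L_def by (subst nth_map) (simp_all add: rev_nth)
    then show ?thesis
      using len by (subst nth) (auto simp: nth_append L_def)
  qed
  have "P ! (L - 1) \<in> set P"
    using len by (auto simp: L_def)
  then have "P ! (L - 1) \<noteq> 0"
    using entries unfolding P_def by blast
  then have "paperfold_inf f (L - 1) \<noteq> paperfold_inf f (L + 1)"
    using a b by simp
  moreover have "L - 1 > m" "L + 1 > m"
    using len by (auto simp: L_def)
  ultimately show ?thesis by metis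
qed


section \<open>Simple continued fractions\<close>

text \<open>The value of the empty list is a dummy.\<close>

fun cfrac_value :: "int list \<Rightarrow> real" where
  "cfrac_value [] = 0"
| "cfrac_value [a] = of_int a"
| "cfrac_value (a # b # xs) = of_int a + 1 / cfrac_value (b # xs)"

text \<open>
  A rational number has exactly two finite simple continued fractions; the expansion is the one
  whose last partial quotient is not \<open>1\<close> (unless it is the only one).
\<close>

definition finite_cfrac_expansion :: "real \<Rightarrow> int list \<Rightarrow> bool" where
  "finite_cfrac_expansion x as \<longleftrightarrow>
     as \<noteq> [] \<and> (\<forall>a\<in>set (tl as). a \<ge> 1) \<and> (length as > 1 \<longrightarrow> last as \<ge> 2) \<and>
     cfrac_value as = x"

definition infinite_cfrac_expansion :: "real \<Rightarrow> (nat \<Rightarrow> int) \<Rightarrow> bool" where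
  "infinite_cfrac_expansion x a \<longleftrightarrow>
     (\<forall>k\<ge>1. a k \<ge> 1) \<and> (\<lambda>k. cfrac_value (map a [0..<Suc k])) \<longlonglongrightarrow> x"


section \<open>The numbers and their partial quotients\<close>

definition alpha_fin :: "nat \<Rightarrow> (nat \<Rightarrow> int) \<Rightarrow> real" where
  "alpha_fin n e = 1 / 2 + 1 / 4 + (\<Sum>i = 2..n. of_int (e i) / 2 ^ (2 ^ i))"

definition alpha_inf :: "(nat \<Rightarrow> int) \<Rightarrow> real" where
  "alpha_inf e = 1 / 2 + 1 / 4 + (\<Sum>i. of_int (e (i + 2)) / 2 ^ (2 ^ (i + 2)))"

lemma summable_alpha_inf:
  assumes "\<forall>i\<ge>2. e i \<in> {-1, 1}"
  shows "summable (\<lambda>i. of_int (e (i + 2)) / 2 ^ (2 ^ (i + 2)) :: real)"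
proof (rule summable_comparison_test')
  show "summable (\<lambda>i. (1 / 2) ^ i :: real)" by (simp add: summable_geometric)
  fix i :: nat
  have "e (i + 2) \<in> {-1, 1}" using assms by simp
  then have 1: "\<bar>of_int (e (i + 2)) :: real\<bar> = 1" by auto
  have "i \<le> 2 ^ (i + 2)"
    using less_exp[of "i + 2"] by linarith
  then have "(2::real) ^ i \<le> 2 ^ (2 ^ (i + 2))" by (intro power_increasing) auto
  then show "norm (of_int (e (i + 2)) / 2 ^ (2 ^ (i + 2)) :: real) \<le> (1 / 2) ^ i"
    using 1 by (simp add: power_one_over frac_le)
qed

definition incr_last :: "int list \<Rightarrow> int list" where
  "incr_last as = butlast as @ [last as + 1]"

definition quotients_fin :: "nat list \<Rightarrow> int list" where
  "quotients_fin R = [0, 1] @ incr_last (map (\<lambda>r. 2 * int r) R)"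

definition quotients_inf :: "(nat \<Rightarrow> nat) \<Rightarrow> nat \<Rightarrow> int" where
  "quotients_inf R k = (if k = 0 then 0 else if k = 1 then 1 else 2 * int (R (k - 2)))"

end

theory Submission
  imports Defs
begin

text \<open>
  For a continuant \<open>K\<close> and a word \<open>w = u x\<close>, the fraction \<open>[0, 1, w']\<close> equals
  \<open>K(w, 1) / K(1, w, 1) = p / q\<close>.  Folding a paperfolding word whose run lengths are \<open>R\<close> with
  \<open>2R = u x\<close> produces the doubled run lengths \<open>u, x, x + 2, u\<^sup>R\<close> or \<open>u, x + 2, x, u\<^sup>R\<close>, according
  to the sign of the new instruction.  Because continuants are invariant under reversal, both words
  have denominator \<open>q\<^sup>2\<close>, and their numerators are \<open>p q \<plusminus> 1\<close>, with the
  sign of the instruction because \<open>w\<close> has even length; so one fold adds \<open>\<plusminus>1 / q\<^sup>2\<close>, where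
  \<open>q = 2 ^ (2 ^ n)\<close>.  The infinite case follows since fractions with \<open>k\<close> common partial quotients
  are within \<open>1 / (k - 1)\<close> of each other.
\<close>

section \<open>Continuants\<close>

text \<open>Euler's continuant, the numerator of the continued fraction with these partial
  quotients; recursing on the first entry matches \<open>cfrac_value\<close>.\<close>

fun continuant :: "int list \<Rightarrow> int" where
  "continuant [] = 1"
| "continuant [a] = a"
| "continuant (a # b # xs) = a * continuant (b # xs) + continuant xs"

text \<open>In the sum over tilings by weighted squares and unit dominoes, the two products collect
  those without and with a domino covering \<open>a\<close> and \<open>b\<close>.\<close>

lemma continuant_append:
  "continuant (xs @ [a, b] @ ys) =
     continuant (xs @ [a]) * continuant (b # ys) + continuant xs * continuant ys"
proof (induction xs rule: continuant.induct)
  case (2 c)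
  show ?case by (cases ys) (simp_all add: algebra_simps)
qed (simp_all add: algebra_simps)

lemma continuant_snoc2:
  "continuant (xs @ [a, b]) = continuant (xs @ [a]) * b + continuant xs"
  using continuant_append[of xs a b "[]"] by simp

lemma continuant_rev: "continuant (rev xs) = continuant xs"
proof (induction xs rule: continuant.induct)
  case (3 a b xs)
  then show ?case by (simp add: continuant_snoc2)
qed simp_all

lemma continuant_snoc_add: "continuant (xs @ [a + d]) = continuant (xs @ [a]) + d * continuant xs"
proof (cases xs rule: rev_cases)
  case (snoc ys y)
  then show ?thesis by (simp add: continuant_snoc2 algebra_simps)
qed simp

text \<open>Continuant form of \<open>[..., a, 1] = [..., a + 1]\<close>. It trades the incremented
  last quotient for an appended \<open>1\<close>, which mirrors the leading \<open>1\<close> and so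
  fits the symmetry of a fold.\<close>

lemma continuant_snoc_1: "continuant (xs @ [a, 1]) = continuant (xs @ [a + 1])"
  by (simp add: continuant_snoc2 continuant_snoc_add)

text \<open>The determinant identity for convergents, with a block \<open>v\<close> appended instead
  of a single entry. Peeling off the first entry of \<open>u\<close> flips the sign;
  \<open>tl v\<close> comes from the case of empty \<open>u\<close>.\<close>

lemma continuant_determinant:
  assumes "v \<noteq> []"
  shows "continuant (a # u @ v) * continuant u - continuant (a # u) * continuant (u @ v) =
           (- 1) ^ length u * continuant (tl v)"
proof (induction u arbitrary: a)
  case Nil
  from assms show ?case by (cases v) simp_all
next
  case (Cons b u)
  have "continuant (a # (b # u) @ v) * continuant (b # u)
          - continuant (a # b # u) * continuant ((b # u) @ v) =
        - (continuant (b # u @ v) * continuant u - continuant (b # u) * continuant (u @ v))"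
    by (simp add: algebra_simps)
  then show ?case by (simp add: Cons.IH)
qed

text \<open>Cut each folded word in the middle; reversal symmetry expresses the right half by the
  left. With the letters of the proof, both denominators are \<open>A * (A + 2 * B) + B * B\<close>,
  so the increment 2 completes the square of \<open>q = A + B\<close>, and the numerators differ
  from \<open>p * q\<close> by the determinant \<open>A * D - B * C\<close>, up to sign.\<close>

lemma continuant_fold:
  fixes c x :: int and u :: "int list"
  defines "p \<equiv> continuant (u @ [x, 1])" and "q \<equiv> continuant (c # u @ [x, 1])"
  shows "continuant (c # u @ [x, x + 2] @ rev u @ [c]) = q\<^sup>2"
    and "continuant (u @ [x, x + 2] @ rev u @ [c]) = p * q - (- 1) ^ length u"
    and "continuant (c # u @ [x + 2, x] @ rev u @ [c]) = q\<^sup>2"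
    and "continuant (u @ [x + 2, x] @ rev u @ [c]) = p * q + (- 1) ^ length u"
proof -
  define A B C D where "A = continuant (c # u @ [x])" and "B = continuant (c # u)"
    and "C = continuant (u @ [x])" and "D = continuant u"
  have r: "continuant (y # rev u @ [c]) = continuant (c # u @ [y])" for y
    using continuant_rev[of "c # u @ [y]"] by simp
  have r0: "continuant (rev u @ [c]) = B"
    using continuant_rev[of "c # u"] by (simp add: B_def)
  have s: "continuant (c # u @ [x + 2]) = A + 2 * B" "continuant (u @ [x + 2]) = C + 2 * D"
    using continuant_snoc_add[of "c # u" x 2] continuant_snoc_add[of u x 2]
    by (simp_all add: A_def B_def C_def D_def)
  have q: "q = A + B" and p: "p = C + D"
    using continuant_snoc2[of "c # u" x 1] continuant_snoc2[of u x 1]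
    by (simp_all add: p_def q_def A_def B_def C_def D_def)
  have det: "A * D - B * C = (- 1) ^ length u"
    using continuant_determinant[of "[x]" c u] by (simp add: A_def B_def C_def D_def)
  note app = continuant_append[of "c # u"] continuant_append[of u]
  show "continuant (c # u @ [x, x + 2] @ rev u @ [c]) = q\<^sup>2"
    using app(1)[of x "x + 2" "rev u @ [c]"]
    by (simp add: r r0 s q power2_eq_square algebra_simps flip: A_def B_def)
  show "continuant (u @ [x, x + 2] @ rev u @ [c]) = p * q - (- 1) ^ length u"
    using app(2)[of x "x + 2" "rev u @ [c]"]
    by (simp add: r r0 s q p algebra_simps flip: A_def B_def C_def D_def det)
  show "continuant (c # u @ [x + 2, x] @ rev u @ [c]) = q\<^sup>2"
    using app(1)[of "x + 2" x "rev u @ [c]"]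
    by (simp add: r r0 s q power2_eq_square algebra_simps flip: A_def B_def)
  show "continuant (u @ [x + 2, x] @ rev u @ [c]) = p * q + (- 1) ^ length u"
    using app(2)[of "x + 2" x "rev u @ [c]"]
    by (simp add: r r0 s q p algebra_simps flip: A_def B_def C_def D_def det)
qed

section \<open>Positivity and growth of continuants\<close>

lemma continuant_pos: "\<forall>a\<in>set xs. a \<ge> 1 \<Longrightarrow> continuant xs \<ge> 1"
proof (induction xs rule: continuant.induct)
  case (3 a b xs)
  then have "a * continuant (b # xs) \<ge> 1 * 1" by (intro mult_mono) auto
  with 3 show ?case by simp
qed simp_all

lemma continuant_Cons_ge:
  assumes "\<forall>a\<in>set (x # xs). a \<ge> 1"
  shows "continuant xs \<le> continuant (x # xs)"
proof (cases xs)
  case Nil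
  with assms show ?thesis by simp
next
  case (Cons y ys)
  have "1 * continuant xs \<le> x * continuant xs"
    using assms continuant_pos[of xs] by (intro mult_right_mono) auto
  moreover have "continuant ys \<ge> 1" using assms Cons by (intro continuant_pos) auto
  ultimately show ?thesis using Cons by simp
qed

lemma continuant_append_ge:
  "\<forall>a\<in>set (xs @ ys). a \<ge> 1 \<Longrightarrow> continuant ys \<le> continuant (xs @ ys)"
proof (induction xs)
  case (Cons x xs)
  then show ?case using continuant_Cons_ge[of x "xs @ ys"] by simp
qed simp

text \<open>Each further entry adds at least \<open>continuant xs \<ge> 1\<close>. This linear bound
  is far below the true exponential growth but suffices for convergence.\<close>

lemma length_le_continuant: "\<forall>a\<in>set xs. a \<ge> 1 \<Longrightarrow> int (length xs) \<le> continuant xs"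
proof (induction xs rule: continuant.induct)
  case (3 a b xs)
  have "1 * continuant (b # xs) \<le> a * continuant (b # xs)"
    using 3 continuant_pos[of "b # xs"] by (intro mult_right_mono) auto
  moreover have "continuant xs \<ge> 1" using 3 by (intro continuant_pos) auto
  moreover have "int (length (b # xs)) \<le> continuant (b # xs)" using 3 by simp
  ultimately have "int (length (b # xs)) + 1 \<le> a * continuant (b # xs) + continuant xs" by linarith
  then show ?case by simp
qed simp_all

section \<open>Continued fraction values as quotients of continuants\<close>

lemma cfrac_value_continuant:
  "\<forall>a\<in>set xs. a \<ge> 1 \<Longrightarrow> cfrac_value (a # xs) = continuant (a # xs) / continuant xs"
proof (induction xs arbitrary: a)
  case (Cons b xs)
  have "continuant (b # xs) \<ge> 1" using Cons.prems by (rule continuant_pos)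
  with Cons show ?case by (simp add: field_simps)
qed simp

text \<open>Over a common denominator the difference is, up to sign,
  \<open>continuant (tl v) / continuant (u @ v)\<close> times \<open>1 / continuant u\<close>; the
  first factor is at most 1, the second at most \<open>1 / length u\<close>.\<close>

lemma cfrac_value_append_dist:
  assumes "\<forall>a\<in>set (u @ v). a \<ge> 1" and "u \<noteq> []" "v \<noteq> []"
  shows "\<bar>cfrac_value (a # u @ v) - cfrac_value (a # u)\<bar> \<le> 1 / length u"
proof -
  have pos: "continuant u \<ge> 1" "continuant (u @ v) \<ge> 1" "continuant (tl v) \<ge> 1"
    using assms by (auto intro!: continuant_pos dest: list.set_sel(2))
  have "continuant (tl v) \<le> continuant ((u @ [hd v]) @ tl v)"
    using assms by (intro continuant_append_ge) simp
  then have tl: "continuant (tl v) \<le> continuant (u @ v)"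
    using assms by simp
  have "cfrac_value (a # u @ v) - cfrac_value (a # u) =
          of_int (continuant (a # u @ v) * continuant u - continuant (a # u) * continuant (u @ v))
            / (of_int (continuant (u @ v)) * of_int (continuant u))"
    using assms pos by (subst (1 2) cfrac_value_continuant) (auto simp: field_simps)
  also have "\<bar>\<dots>\<bar> = continuant (tl v) / continuant (u @ v) * (1 / continuant u)"
    using pos unfolding continuant_determinant[OF assms(3)]
    by (simp add: abs_mult power_abs)
  also have "\<dots> \<le> 1 * (1 / continuant u)"
    using pos tl by (intro mult_right_mono) auto
  also have "\<dots> \<le> 1 / length u"
    using assms length_le_continuant[of u]
    by (simp add: frac_le)
  finally show ?thesis .
qed


section \<open>Run lengths\<close>

lemma run_lengths_eq_Nil_iff [simp]: "run_lengths xs = [] \<longleftrightarrow> xs = []"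
  by (cases xs) simp_all

lemma run_lengths_pos: "r \<in> set (run_lengths xs) \<Longrightarrow> r > 0"
  by (induction xs rule: run_lengths.induct) auto

lemma run_lengths_append:
  "xs \<noteq> [] \<Longrightarrow> ys \<noteq> [] \<Longrightarrow> last xs \<noteq> hd ys \<Longrightarrow>
     run_lengths (xs @ ys) = run_lengths xs @ run_lengths ys"
proof (induction xs rule: run_lengths.induct)
  case (2 x xs)
  show ?case
  proof (cases "\<forall>y\<in>set xs. y = x")
    case True
    then have "last (x # xs) = x" by (cases xs rule: rev_cases) auto
    with 2 have "hd ys \<noteq> x" by simp
    with 2 have "takeWhile (\<lambda>y. y = x) ys = []" "dropWhile (\<lambda>y. y = x) ys = ys"
      by (cases ys; simp)+
    moreover have "dropWhile (\<lambda>y. y = x) xs = []" "takeWhile (\<lambda>y. y = x) xs = xs"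
      using True by (simp_all only: takeWhile_eq_all_conv dropWhile_eq_Nil_conv)
    ultimately show ?thesis using True by (simp del: takeWhile_eq_all_conv)
  next
    case False
    then obtain y where y: "y \<in> set xs" "y \<noteq> x" by blast
    then have ne: "dropWhile (\<lambda>y. y = x) xs \<noteq> []" by auto
    then have "last (dropWhile (\<lambda>y. y = x) xs) = last (x # xs)"
      by (metis last_ConsR last_appendR takeWhile.simps(1) dropWhile.simps(1) takeWhile_dropWhile_id)
    with 2 ne y show ?thesis by (auto simp: takeWhile_append1 dropWhile_append1)
  qed
qed simp

lemma run_lengths_replicate: "run_lengths (replicate (Suc n) x) = [Suc n]"
  by (simp add: takeWhile_eq_all_conv)

lemma run_decomposition:
  "x # xs = replicate (Suc (length (takeWhile (\<lambda>y. y = x) xs))) x @ dropWhile (\<lambda>y. y = x) xs"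
proof -
  have "takeWhile (\<lambda>y. y = x) xs = replicate (length (takeWhile (\<lambda>y. y = x) xs)) x"
    by (subst replicate_length_same) (auto dest: set_takeWhileD)
  then show ?thesis by (metis append_Cons replicate_Suc takeWhile_dropWhile_id)
qed

text \<open>The first run becomes the last one of the reversal, and it cannot merge with what
  precedes it because the rest \<open>ys\<close> does not begin with \<open>x\<close>.\<close>

lemma run_lengths_rev: "run_lengths (rev xs) = rev (run_lengths xs)"
proof (induction xs rule: run_lengths.induct)
  case (2 x xs)
  define m ys where "m = length (takeWhile (\<lambda>y. y = x) xs)" and "ys = dropWhile (\<lambda>y. y = x) xs"
  have "rev (x # xs) = rev ys @ replicate (Suc m) x"
    unfolding m_def ys_def by (subst run_decomposition) (simp add: replicate_append_same)
  moreover have "run_lengths (rev ys @ replicate (Suc m) x) = rev (run_lengths ys) @ [Suc m]"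
  proof (cases "ys = []")
    case True
    then show ?thesis using run_lengths_replicate by simp
  next
    case False
    moreover from this have "hd ys \<noteq> x" unfolding ys_def using hd_dropWhile by blast
    ultimately have "run_lengths (rev ys @ replicate (Suc m) x) =
        run_lengths (rev ys) @ run_lengths (replicate (Suc m) x)"
      by (intro run_lengths_append) (auto simp: last_rev)
    then show ?thesis using 2 run_lengths_replicate by (simp add: ys_def)
  qed
  ultimately show ?case by (simp add: m_def ys_def)
qed simp

lemma run_lengths_uminus: "run_lengths (map uminus xs) = run_lengths xs"
proof (induction xs rule: run_lengths.induct)
  case (2 x xs)
  then show ?case by (simp add: takeWhile_map dropWhile_map comp_def)
qed simp

lemma run_lengths_Cons_same:
  "xs \<noteq> [] \<Longrightarrow> hd xs = x \<Longrightarrow>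
     run_lengths (x # xs) = Suc (hd (run_lengths xs)) # tl (run_lengths xs)"
  by (cases xs) simp_all

text \<open>The negated reversal of \<open>P\<close> begins with \<open>1\<close>, opposite to the
  end of \<open>P\<close>. Hence a middle \<open>1\<close> lengthens the first run on the right, and
  a middle \<open>- 1\<close> the last run on the left.\<close>

lemma run_lengths_fold:
  assumes "P \<noteq> []" "last P = - 1" "run_lengths P = v @ [r]"
  shows "run_lengths (P @ [1] @ map uminus (rev P)) = v @ [r, Suc r] @ rev v"
    and "run_lengths (P @ [- 1] @ map uminus (rev P)) = v @ [Suc r, r] @ rev v"
proof -
  define Q where "Q = map uminus (rev P)"
  have Q: "Q \<noteq> []" "hd Q = 1" "run_lengths Q = r # rev v"
    using assms by (auto simp: Q_def hd_map hd_rev run_lengths_uminus run_lengths_rev)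
  have "run_lengths (P @ 1 # Q) = run_lengths P @ run_lengths (1 # Q)"
    using assms by (intro run_lengths_append) auto
  then show "run_lengths (P @ [1] @ map uminus (rev P)) = v @ [r, Suc r] @ rev v"
    using Q run_lengths_Cons_same[of Q 1] assms unfolding Q_def[symmetric]
    by (simp del: run_lengths.simps)
  \<comment> \<open>\<open>run_lengths\<close> consumes lists from the front, so appending
    \<open>- 1\<close> to \<open>P\<close> is handled by prepending it to the reversal.\<close>
  have "run_lengths (- 1 # rev P) = Suc r # rev v"
    using assms run_lengths_Cons_same[of "rev P" "- 1"]
    by (simp add: hd_rev run_lengths_rev del: run_lengths.simps)
  then have "run_lengths (P @ [- 1]) = v @ [Suc r]"
    using run_lengths_rev[of "- 1 # rev P"] by (simp del: run_lengths.simps)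
  moreover have "run_lengths ((P @ [- 1]) @ Q) = run_lengths (P @ [- 1]) @ run_lengths Q"
    using Q by (intro run_lengths_append) auto
  ultimately show "run_lengths (P @ [- 1] @ map uminus (rev P)) = v @ [Suc r, r] @ rev v"
    using Q unfolding Q_def[symmetric] by simp
qed

text \<open>Prepares the \<open>LEAST\<close> in \<open>run_start\<close>: position
  \<open>s j\<close> is where run \<open>j\<close> starts. The induction removes the first run,
  which shifts all positions by its length.\<close>

lemma run_boundaries:
  assumes "Suc i < length (run_lengths xs)"
  defines "s \<equiv> \<lambda>j. sum_list (take j (run_lengths xs))"
  shows "s (Suc i) < length xs \<and> xs ! s (Suc i) \<noteq> xs ! s i \<and>
           (\<forall>k. s i \<le> k \<and> k < s (Suc i) \<longrightarrow> xs ! k = xs ! s i)"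
  using assms(1) unfolding s_def
proof (induction xs arbitrary: i rule: run_lengths.induct)
  case (2 x xs)
  define m ys where "m = length (takeWhile (\<lambda>y. y = x) xs)" and "ys = dropWhile (\<lambda>y. y = x) xs"
  have xs: "x # xs = replicate (Suc m) x @ ys"
    unfolding m_def ys_def by (rule run_decomposition)
  have nth: "k < Suc m \<Longrightarrow> (x # xs) ! k = x" "(x # xs) ! (Suc m + k) = ys ! k" for k
    by (simp_all only: xs nth_append length_replicate nth_replicate if_True) simp
  have len: "length (x # xs) = Suc m + length ys"
    by (simp only: xs length_append length_replicate)
  have R: "run_lengths (x # xs) = Suc m # run_lengths ys" by (simp add: m_def ys_def)
  have ne: "ys \<noteq> []" using 2(2) R by auto
  then have "hd ys \<noteq> x" unfolding ys_def using hd_dropWhile by blast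
  with ne have hd: "ys ! 0 \<noteq> x" by (simp add: hd_conv_nth)
  define t where "t = (\<lambda>j. sum_list (take j (run_lengths ys)))"
  have s: "sum_list (take (Suc l) (Suc m # run_lengths ys)) = Suc m + t l" for l
    by (simp add: t_def)
  show ?case
  proof (cases i)
    case 0
    have "t 0 = 0" by (simp add: t_def)
    moreover have "(x # xs) ! 0 = x" by simp
    ultimately show ?thesis unfolding R 0 s len take_0 sum_list.Nil nth(2)
      using ne hd nth(1) by (metis add.right_neutral add_less_cancel_left length_greater_0_conv)
  next
    case (Suc j)
    have "Suc j < length (run_lengths ys)" using 2(2) unfolding R Suc by simp
    from 2(1)[folded ys_def, OF this]
    have IH: "Suc m + t (Suc j) < Suc m + length ys" "ys ! t (Suc j) \<noteq> ys ! t j"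
       "\<And>k. t j \<le> k \<Longrightarrow> k < t (Suc j) \<Longrightarrow> ys ! k = ys ! t j"
      unfolding t_def add_less_cancel_left by blast+
    have "(x # xs) ! k = ys ! t j" if "Suc m + t j \<le> k" "k < Suc m + t (Suc j)" for k
      using IH(3)[of "k - Suc m"] nth(2)[of "k - Suc m"] that by simp
    then show ?thesis unfolding R Suc s len nth(2) using IH(1,2) by blast
  qed
next
  case 1
  then show ?case by simp
qed

lemma run_start_prefix:
  assumes "has_prefix p xs" "i < length (run_lengths xs)"
  shows "run_start p i = sum_list (take i (run_lengths xs))"
  using assms(2)
proof (induction i)
  case (Suc i)
  define s where "s = (\<lambda>j. sum_list (take j (run_lengths xs)))"
  have b: "s (Suc i) < length xs" "xs ! s (Suc i) \<noteq> xs ! s i"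
    "\<And>k. s i \<le> k \<Longrightarrow> k < s (Suc i) \<Longrightarrow> xs ! k = xs ! s i"
    using run_boundaries[OF Suc.prems] unfolding s_def by blast+
  have "take (Suc i) (run_lengths xs) = take i (run_lengths xs) @ [run_lengths xs ! i]"
    using Suc.prems by (simp add: take_Suc_conv_app_nth)
  moreover have "run_lengths xs ! i > 0"
    using Suc.prems by (intro run_lengths_pos[OF nth_mem]) simp
  ultimately have less: "s i < s (Suc i)" by (simp add: s_def)
  have p: "p k = xs ! k" if "k < length xs" for k
    using assms(1) that by (simp add: has_prefix_iff)
  have "(LEAST k. s i < k \<and> p k \<noteq> p (s i)) = s (Suc i)"
  proof (rule Least_equality)
    show "s i < s (Suc i) \<and> p (s (Suc i)) \<noteq> p (s i)" using b(1,2) less by (simp add: p)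
    fix k assume k: "s i < k \<and> p k \<noteq> p (s i)"
    show "s (Suc i) \<le> k"
    proof (rule ccontr)
      assume "\<not> s (Suc i) \<le> k"
      with k b(1) have "p k = xs ! k" "p (s i) = xs ! s i" "xs ! k = xs ! s i"
        by (auto intro!: p b(3))
      with k show False by argo
    qed
  qed
  with Suc show ?case by (simp add: s_def)
qed simp

text \<open>The last run of the prefix is excluded, since it may continue in \<open>p\<close> beyond
  the prefix; its start is reliable, its length is not.\<close>

lemma run_start_diff_prefix:
  assumes "has_prefix p xs" "Suc i < length (run_lengths xs)"
  shows "run_start p (Suc i) - run_start p i = run_lengths xs ! i"
  using assms(2) run_start_prefix[OF assms(1), of i] run_start_prefix[OF assms(1), of "Suc i"]
  by (simp only: take_Suc_conv_app_nth Suc_lessD) simp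


section \<open>Folding and the numbers \<open>\<alpha>\<close>\<close>

text \<open>The invariant behind both expansions. The end entries make
  \<open>run_lengths_fold\<close> applicable, parity fixes the sign in
  \<open>continuant_fold\<close>, and the length bound supplies enough quotients for the infinite
  case. It starts at \<open>n = 2\<close> because the word \<open>[1]\<close> ends in
  \<open>1\<close>.\<close>

lemma paperfold_runs:
  fixes e :: "nat \<Rightarrow> int"
  assumes "n \<ge> 2" "\<forall>i\<in>{2..n}. e i \<in> {-1, 1}"
  defines "P \<equiv> \<lambda>n. paperfold (1 # map e [2..<Suc n])"
    and "w \<equiv> \<lambda>n. map (\<lambda>r. 2 * int r) (run_lengths_of (1 # map e [2..<Suc n]))"
  shows "P n \<noteq> [] \<and> hd (P n) = 1 \<and> last (P n) = - 1 \<and>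
         even (length (w n)) \<and> n \<le> length (w n) \<and>
         continuant (1 # w n @ [1]) = 2 ^ (2 ^ n) \<and>
         continuant (w n @ [1]) = alpha_fin n e * 2 ^ (2 ^ n)"
  using assms(1,2)
proof (induction n rule: dec_induct)
  case base
  have "P 2 = paperfold (([] @ [1]) @ [e 2])" by (simp add: P_def upt_rec)
  also have "\<dots> = [1, e 2, - 1]" by (simp only: paperfold_snoc paperfold_Nil) simp
  finally have P: "P 2 = [1, e 2, - 1]" .
  have w: "w 2 = map (\<lambda>r. 2 * int r) (run_lengths (P 2))"
    by (simp add: w_def P_def run_lengths_of_def)
  from base have "e 2 = 1 \<or> e 2 = - 1" by auto
  then show ?case by (auto simp: w P alpha_fin_def)
next
  case (step n)
  note n = \<open>2 \<le> n\<close>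
  have IH: "P n \<noteq> []" "hd (P n) = 1" "last (P n) = - 1" "even (length (w n))" "n \<le> length (w n)"
    "continuant (1 # w n @ [1]) = 2 ^ (2 ^ n)"
    "continuant (w n @ [1]) = alpha_fin n e * 2 ^ (2 ^ n)"
    using step by auto
  define a where "a = e (Suc n)"
  have a: "a = 1 \<or> a = - 1" using step.prems n by (auto simp: a_def)
  have w: "w m = map (\<lambda>r. 2 * int r) (run_lengths (P m))" for m
    by (simp add: w_def P_def run_lengths_of_def)
  have P: "P (Suc n) = P n @ [a] @ map uminus (rev (P n))"
    using n paperfold_snoc[of "1 # map e [2..<Suc n]" a] by (simp add: P_def a_def)
  obtain v r where vr: "run_lengths (P n) = v @ [r]"
    using IH(1) by (metis run_lengths_eq_Nil_iff rev_exhaust)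
  define u x where "u = map (\<lambda>r. 2 * int r) v" and "x = 2 * int r"
  have wn: "w n = u @ [x]" by (simp add: w vr u_def x_def)
  \<comment> \<open>Without \<open>x\<close> an odd number of entries remains, so
    \<open>(- 1) ^ length u = - 1\<close> and the correction to \<open>p * q\<close> becomes exactly
    \<open>a\<close>.\<close>
  have odd: "odd (length u)" using IH(4) by (simp add: wn)
  have wS: "w (Suc n) = u @ (if a = 1 then [x, x + 2] else [x + 2, x]) @ rev u"
    using a run_lengths_fold[OF IH(1,3) vr] unfolding w P
    by (auto simp: u_def x_def rev_map)
  have len: "length (w (Suc n)) = 2 * length (w n)" by (simp add: wS wn)
  define p q where "p = continuant (w n @ [1])" and "q = continuant (1 # w n @ [1])"
  have "continuant (1 # w (Suc n) @ [1]) = q\<^sup>2"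
    using continuant_fold(1,3)[of 1 u x] unfolding wS q_def wn by simp
  then have q': "continuant (1 # w (Suc n) @ [1]) = 2 ^ (2 ^ Suc n)"
    using IH(6) by (simp add: q_def mult.commute flip: power_mult)
  have p': "continuant (w (Suc n) @ [1]) = p * q + a"
    using continuant_fold(2,4)[where c = 1 and u = u and x = x] a odd unfolding wS p_def q_def wn
    by auto
  have alpha: "alpha_fin (Suc n) e = alpha_fin n e + a / 2 ^ (2 ^ Suc n)"
    using n by (simp add: alpha_fin_def a_def)
  \<comment> \<open>Division by \<open>q\<^sup>2 = 2 ^ (2 ^ Suc n)\<close> turns
    \<open>p * q + a\<close> into \<open>p / q + a / q\<^sup>2\<close>, the old value plus the new
    term.\<close>
  have "real_of_int (p * q + a) = alpha_fin n e * 2 ^ (2 ^ n) * 2 ^ (2 ^ n) + a"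
    using IH(6,7) by (simp add: p_def q_def)
  also have "\<dots> = alpha_fin (Suc n) e * 2 ^ (2 ^ Suc n)"
  proof -
    have "(2::real) ^ (2 ^ n) * 2 ^ (2 ^ n) = 2 ^ (2 ^ Suc n)"
      by (simp flip: power_add mult_2)
    then show ?thesis unfolding alpha by (simp add: distrib_right mult.assoc del: power_Suc)
  qed
  finally have "real_of_int (continuant (w (Suc n) @ [1])) = alpha_fin (Suc n) e * 2 ^ (2 ^ Suc n)"
    using p' by simp
  moreover have "hd (P (Suc n)) = 1" "last (P (Suc n)) = - 1" "P (Suc n) \<noteq> []"
    using IH(1,2) by (simp_all add: P last_map last_rev)
  ultimately show ?case using len IH(5) n q' by simp
qed

text \<open>By \<open>continuant_snoc_1\<close> the trailing \<open>1\<close> of the invariant is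
  absorbed into the last quotient, which explains its increment. That quotient is then at least 3,
  so the normalisation of the last term holds.\<close>

lemma quotients_fin_expansion:
  fixes e :: "nat \<Rightarrow> int"
  assumes "n \<ge> 2" "\<forall>i\<in>{2..n}. e i \<in> {-1, 1}"
  shows "finite_cfrac_expansion (alpha_fin n e)
           (quotients_fin (run_lengths_of (1 # map e [2..<Suc n])))"
proof -
  define w where "w = map (\<lambda>r. 2 * int r) (run_lengths_of (1 # map e [2..<Suc n]))"
  note runs = paperfold_runs[OF assms, folded w_def]
  then have "w \<noteq> []" using assms by auto
  then obtain v y where w: "w = v @ [y]" using rev_exhaust by blast
  have pos: "\<forall>a\<in>set w. a \<ge> 2"
    using run_lengths_pos unfolding w_def run_lengths_of_def by fastforce
  define t where "t = 1 # v @ [y + 1]"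
  have q: "quotients_fin (run_lengths_of (1 # map e [2..<Suc n])) = 0 # t"
    unfolding quotients_fin_def w_def[symmetric] by (simp add: w incr_last_def t_def)
  have t: "\<forall>a\<in>set t. a \<ge> 1" using pos by (fastforce simp: w t_def)
  have "cfrac_value (0 # t) = continuant (v @ [y + 1]) / continuant (1 # v @ [y + 1])"
    using cfrac_value_continuant[OF t, of 0] by (simp add: t_def)
  also have "\<dots> = alpha_fin n e"
  proof -
    have "real_of_int (continuant (1 # v @ [y + 1])) = 2 ^ (2 ^ n)"
      using runs continuant_snoc_1[of "1 # v" y] by (simp add: w)
    then show ?thesis using runs continuant_snoc_1[of v y] by (simp add: w)
  qed
  finally show ?thesis
    using t pos unfolding q finite_cfrac_expansion_def by (simp add: t_def w)
qed

section \<open>Passage to infinite instruction sequences\<close>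

lemma alpha_fin_tendsto:
  assumes "\<forall>i\<ge>2. e i \<in> {-1, 1}"
  shows "(\<lambda>n. alpha_fin n e) \<longlonglongrightarrow> alpha_inf e"
proof -
  have "(\<lambda>n. \<Sum>i<n. of_int (e (i + 2)) / 2 ^ (2 ^ (i + 2)) :: real)
          \<longlonglongrightarrow> (\<Sum>i. of_int (e (i + 2)) / 2 ^ (2 ^ (i + 2)))"
    by (rule summable_LIMSEQ[OF summable_alpha_inf[OF assms]])
  \<comment> \<open>The sum in \<open>alpha_fin\<close> starts at index 2, so \<open>n\<close> terms
    end at index \<open>n + 1\<close>.\<close>
  moreover have "alpha_fin (n + 1) e = 1 / 2 + 1 / 4 + (\<Sum>i<n. of_int (e (i + 2)) / 2 ^ (2 ^ (i + 2)))" for n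
    by (induction n) (simp_all add: alpha_fin_def)
  ultimately have "(\<lambda>n. alpha_fin (n + 1) e) \<longlonglongrightarrow> alpha_inf e"
    unfolding alpha_inf_def by (simp only:) (intro tendsto_intros)
  then show ?thesis by (rule LIMSEQ_offset)
qed

text \<open>For fixed \<open>k\<close> and large \<open>n\<close>, the expansion of
  \<open>alpha_fin n e\<close> shares its first \<open>k\<close> quotients after the leading 0 with
  the infinite one, so it lies within \<open>1 / k\<close> of that convergent. Letting
  \<open>n\<close> grow carries the bound to \<open>alpha_inf e\<close>; then \<open>k\<close>
  grows.\<close>

lemma quotients_inf_expansion:
  fixes e :: "nat \<Rightarrow> int"
  assumes "\<forall>i\<ge>2. e i \<in> {-1, 1}"
  shows "infinite_cfrac_expansion (alpha_inf e)
           (quotients_inf (run_lengths_inf_of (\<lambda>j. if j = 0 then 1 else e (j + 1))))"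
proof -
  define f where "f = (\<lambda>j. if j = 0 then 1 else e (j + 1))"
  define S where "S = run_lengths_inf_of f"
  define R where "R = (\<lambda>n. run_lengths_of (1 # map e [2..<Suc n]))"
  have long: "n \<le> length (R n)" if "n \<ge> 2" for n
    using paperfold_runs[of n e] that assms by (simp add: R_def)
  \<comment> \<open>The word for \<open>n\<close> has at least \<open>n\<close> runs, so
    \<open>Suc i < n\<close> ensures that run \<open>i\<close> is not its last, possibly unfinished
    one.\<close>
  have SR: "S i = R n ! i" if "n \<ge> 2" "Suc i < n" for n i
  proof -
    obtain m where m: "n = Suc m" using \<open>n \<ge> 2\<close> by (cases n) auto
    have "map f [0..<Suc m] = 1 # map e [2..<Suc n]"
      by (rule nth_equalityI) (auto simp: m f_def nth_Cons' nth_append simp del: upt_Suc)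
    then have "has_prefix (paperfold_inf f) (paperfold (1 # map e [2..<Suc n]))"
      using paperfold_inf_prefix[of f m] by simp
    then show ?thesis
      using long[of n] that
      by (auto simp: S_def R_def run_lengths_inf_of_def run_lengths_of_def
          simp del: run_start.simps intro!: run_start_diff_prefix)
  qed
  have R_pos: "r > 0" if "r \<in> set (R n)" for r n
    using that run_lengths_pos by (auto simp: R_def run_lengths_of_def)
  have S_pos: "S i > 0" for i
    using SR[of "i + 2" i] long[of "i + 2"] R_pos[of "S i" "i + 2"] by simp
  define a where "a = quotients_inf S"
  have a_pos: "a k \<ge> 1" if "k \<ge> 1" for k
    using that S_pos[of "k - 2"] by (auto simp: a_def quotients_inf_def)
  have bound: "\<bar>alpha_inf e - cfrac_value (map a [0..<Suc k])\<bar> \<le> 1 / k" if k: "k \<ge> 1" for k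
  proof (rule Lim_bounded)
    show "(\<lambda>n. \<bar>alpha_fin n e - cfrac_value (map a [0..<Suc k])\<bar>)
            \<longlonglongrightarrow> \<bar>alpha_inf e - cfrac_value (map a [0..<Suc k])\<bar>"
      using assms by (intro tendsto_intros alpha_fin_tendsto)
    \<comment> \<open>With \<open>n \<ge> k + 2\<close> the incremented last quotient lies beyond
      the first \<open>k\<close> entries of \<open>t\<close>.\<close>
    show "\<forall>n\<ge>k + 2. \<bar>alpha_fin n e - cfrac_value (map a [0..<Suc k])\<bar> \<le> 1 / k"
    proof (intro allI impI)
      fix n assume n: "n \<ge> k + 2"
      define t where "t = 1 # incr_last (map (\<lambda>r. 2 * int r) (R n))"
      have "finite_cfrac_expansion (alpha_fin n e) (quotients_fin (R n))"
        unfolding R_def using assms n by (intro quotients_fin_expansion) auto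
      moreover have "quotients_fin (R n) = 0 # t" by (simp add: quotients_fin_def t_def)
      ultimately have t: "\<forall>a\<in>set t. a \<ge> 1" "cfrac_value (0 # t) = alpha_fin n e"
        by (auto simp: finite_cfrac_expansion_def)
      have len: "length t = Suc (length (R n))" "length (R n) \<ge> n"
        using n long[of n] by (cases "R n"; simp add: t_def incr_last_def)+
      define u where "u = map a [1..<Suc k]"
      have "take k t = u"
      proof (rule nth_equalityI)
        fix i assume "i < length (take k t)"
        then have "i < k" by simp
        then show "take k t ! i = u ! i"
          using n len SR[of n "i - 1"]
          by (auto simp: u_def t_def incr_last_def a_def quotients_inf_def nth_Cons' nth_append
              nth_butlast simp del: upt_Suc)
      qed (use n len in \<open>simp add: u_def\<close>)
      then have split: "t = u @ drop k t" by (metis append_take_drop_id)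
      have "\<bar>cfrac_value (0 # u @ drop k t) - cfrac_value (0 # u)\<bar> \<le> 1 / length u"
        using t(1) split k n len by (intro cfrac_value_append_dist) (auto simp: u_def)
      moreover have "map a [0..<Suc k] = 0 # u"
        by (subst upt_conv_Cons) (simp_all add: u_def a_def quotients_inf_def)
      ultimately show "\<bar>alpha_fin n e - cfrac_value (map a [0..<Suc k])\<bar> \<le> 1 / k"
        using t(2) split by (simp add: u_def del: upt_Suc)
    qed
  qed
  have "(\<lambda>k. cfrac_value (map a [0..<Suc k]) - alpha_inf e) \<longlonglongrightarrow> 0"
  proof (rule tendsto_0_le[OF lim_1_over_n])
    show "\<forall>\<^sub>F k in sequentially.
            norm (cfrac_value (map a [0..<Suc k]) - alpha_inf e) \<le> norm (1 / real k) * 1"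
      using bound by (intro eventually_sequentiallyI[of 1]) (simp add: abs_minus_commute)
  qed
  then have "(\<lambda>k. cfrac_value (map a [0..<Suc k])) \<longlonglongrightarrow> alpha_inf e"
    by (rule LIM_zero_cancel)
  then show ?thesis
    using a_pos unfolding infinite_cfrac_expansion_def a_def S_def f_def by blast
qed

theorem theorem11:
  shows "(\<forall>(n::nat) (e :: nat \<Rightarrow> int). n \<ge> 2 \<longrightarrow> (\<forall>i\<in>{2..n}. e i \<in> {-1, 1}) \<longrightarrow>
            finite_cfrac_expansion (alpha_fin n e)
              (quotients_fin (run_lengths_of (1 # map e [2..<Suc n])))) \<and>
         (\<forall>e :: nat \<Rightarrow> int. (\<forall>i\<ge>2. e i \<in> {-1, 1}) \<longrightarrow>
            infinite_cfrac_expansion (alpha_inf e)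
              (quotients_inf (run_lengths_inf_of (\<lambda>j. if j = 0 then 1 else e (j + 1)))))"
  using quotients_fin_expansion quotients_inf_expansion by blast

end
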